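(* Let $n\in\mathbb{N}$, $d\in\mathbb{N}_0$, let $S\subseteq\mathbb{R}[x_1,\dots,x_n]_{\leq d}$, and let $C\subseteq\mathbb{R}[x_1,\dots,x_n]_{\leq d}$ be a full dimensional cone such that there is a linear functional $l:\mathbb{R}[x_1,\dots,x_n]_{\leq d}\to\mathbb{R}$ with $l(p)>0$ for all $p\in\left(\overline{\mathrm{cone}\,S}\cup C\right)\setminus\{0\}$. If $f\in\mathrm{int}\,C$ and the linear operator $A$ is defined by \[A:\mathbb{R}[x_1,\dots,x_n]_{\leq d}\to\mathbb{R}[x_1,\dots,x_n]_{\leq d},\quad p\mapsto Ap:=l(p)\cdot f,\] then there exists a constant $\tau=\tau(f,C,S,l)>0$ such that $e^{tA}S\subseteq C$ for all $t\geq\tau$.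
   Context: $\mathbb{N}=\{1,2,\dots\}$, $\mathbb{N}_0=\{0,1,2,\dots\}$. $\mathbb{R}[x_1,\dots,x_n]_{\leq d}$ is the finite dimensional real vector space of polynomials of total degree at most $d$, with its usual (Euclidean) topology; closure and interior $\mathrm{int}$ are taken in it. A cone is a set $C$ containing $0$ with $\lambda C\subseteq C$ for all $\lambda\geq 0$; it is full dimensional if it has non-empty interior. $\mathrm{cone}\,S$ is the cone generated by $S$, i.e. $\{\lambda s : \lambda\geq 0,\ s\in S\}$. $e^{tA}=\sum_{k\geq 0}\frac{t^k}{k!}A^k$ is the usual exponential of an endomorphism of a finite dimensional space, and $e^{tA}S=\{e^{tA}p : p\in S\}$. *)

theory Defs
  imports "HOL-Analysis.Analysis" "HOL-Analysis.Finite_Function_Topology"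
begin

text \<open>
  A polynomial is its finitely supported family of coefficients, indexed by monomials; a monomial
  is a finitely supported family of exponents, the number \<open>i\<close> standing for the variable \<open>x\<^sub>i\<close>.
  The vector space structure and the norm (the sum of the absolute values of the coefficients) are
  those of \<^theory>\<open>HOL-Analysis.Finite_Function_Topology\<close>.
\<close>

type_synonym monomial = "nat \<Rightarrow>\<^sub>0 nat"
type_synonym real_mpoly = "monomial \<Rightarrow>\<^sub>0 real"

definition total_degree :: "monomial \<Rightarrow> nat" where
  "total_degree m = (\<Sum>i\<in>Poly_Mapping.keys m. Poly_Mapping.lookup m i)"

definition polys_le :: "nat \<Rightarrow> nat \<Rightarrow> real_mpoly set" where
  "polys_le n d =
    {p. \<forall>m\<in>Poly_Mapping.keys p. Poly_Mapping.keys m \<subseteq> {1..n} \<and> total_degree m \<le> d}"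

text \<open>
  The Euclidean topology of the finite-dimensional space \<open>polys_le n d\<close>. All norms on it are
  equivalent, so it is the subspace topology. The interior has to be taken relative to this
  subspace, which has empty interior in the infinite-dimensional space \<^typ>\<open>real_mpoly\<close>.
\<close>

definition polys_le_top :: "nat \<Rightarrow> nat \<Rightarrow> real_mpoly topology" where
  "polys_le_top n d = top_of_set (polys_le n d)"

text \<open>The library's \<^const>\<open>cone\<close> admits the empty set.\<close>

definition cone_with_zero :: "'a::real_vector set \<Rightarrow> bool" where
  "cone_with_zero C \<longleftrightarrow> 0 \<in> C \<and> cone C"

definition full_dimensional :: "nat \<Rightarrow> nat \<Rightarrow> real_mpoly set \<Rightarrow> bool" where
  "full_dimensional n d C \<longleftrightarrow> polys_le_top n d interior_of C \<noteq> {}"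

definition linear_functional_on :: "'a::real_vector set \<Rightarrow> ('a \<Rightarrow> real) \<Rightarrow> bool" where
  "linear_functional_on V l \<longleftrightarrow>
    (\<forall>p\<in>V. \<forall>q\<in>V. l (p + q) = l p + l q) \<and> (\<forall>c. \<forall>p\<in>V. l (c *\<^sub>R p) = c * l p)"

text \<open>
  \<open>exp_op t A p\<close> is \<open>e\<^bsup>tA\<^esup>p\<close>. If \<open>A\<close> restricts to an endomorphism of a finite-dimensional
  subspace, then the series converges absolutely for every \<open>p\<close> in it, and the sum depends only on
  the restriction of \<open>A\<close>.
\<close>

definition exp_op :: "real \<Rightarrow> ('a::real_normed_vector \<Rightarrow> 'a) \<Rightarrow> 'a \<Rightarrow> 'a" where
  "exp_op t A p = suminf (\<lambda>k. (t ^ k / fact k) *\<^sub>R (A ^^ k) p)"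

end

theory Submission
  imports Defs
begin

text \<open>
  Since \<open>A\<close> has rank one, \<open>e\<^bsup>tA\<^esup>p = p + ((e\<^bsup>t l(f)\<^esup> - 1) / l(f)) l(p) f\<close>, which is a positive
  multiple of \<open>f + p / (s l(p))\<close> for some \<open>s \<ge> t\<close>. On the compact intersection of the unit sphere
  with the closed cone generated by \<open>S\<close> the functional \<open>l\<close> is bounded below by a positive number,
  so \<open>p / l(p)\<close> is bounded on \<open>S - {0}\<close>, and for large \<open>t\<close> the perturbation stays in a
  neighbourhood of \<open>f\<close> contained in \<open>C\<close>.
\<close>

section \<open>Coefficient functionals and compact sets of coefficient families\<close>

lemma lookup_scaleR: "Poly_Mapping.lookup (c *\<^sub>R p) m = c *\<^sub>R Poly_Mapping.lookup p m"
proof -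
  have "finite {i. c *\<^sub>R Poly_Mapping.lookup p i \<noteq> 0}"
    by (rule finite_subset[of _ "Poly_Mapping.keys p"]) (auto simp: in_keys_iff)
  then show ?thesis
    by (simp add: scaleR_poly_mapping_def lookup_Abs_poly_mapping)
qed

lemma norm_lookup_le: "norm (Poly_Mapping.lookup p m) \<le> norm p"
proof (cases "m \<in> Poly_Mapping.keys p")
  case True
  then show ?thesis
    by (auto simp: norm_poly_mapping_def dist_poly_mapping_def intro: member_le_sum)
next
  case False
  then show ?thesis by (simp add: in_keys_iff)
qed

lemma bounded_linear_lookup: "bounded_linear (\<lambda>p. Poly_Mapping.lookup p m)"
  by (rule bounded_linear_intro[of _ 1]) (simp_all add: lookup_add lookup_scaleR norm_lookup_le)

lemma poly_mapping_eq_sum_single: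
  fixes p :: "'a \<Rightarrow>\<^sub>0 real"
  assumes "finite M" "Poly_Mapping.keys p \<subseteq> M"
  shows "p = (\<Sum>m\<in>M. Poly_Mapping.lookup p m *\<^sub>R Poly_Mapping.single m 1)"
proof (rule poly_mapping_eqI)
  fix i
  have "(\<Sum>m\<in>M. Poly_Mapping.lookup p m * Poly_Mapping.lookup (Poly_Mapping.single m 1) i)
      = (\<Sum>m\<in>M. if m = i then Poly_Mapping.lookup p i else 0)"
    by (intro sum.cong) (auto simp: lookup_single when_def)
  also have "\<dots> = Poly_Mapping.lookup p i"
    using assms by (auto simp: in_keys_iff)
  finally show "Poly_Mapping.lookup p i
      = Poly_Mapping.lookup (\<Sum>m\<in>M. Poly_Mapping.lookup p m *\<^sub>R Poly_Mapping.single m 1) i"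
    by (simp add: lookup_sum lookup_scaleR)
qed

text \<open>Closed bounded sets of finitely supported families need not be compact, so compactness
  is built up one coordinate at a time: the cube over \<open>insert a M\<close> is the continuous
  image of the product of \<open>{-1..1}\<close> and the cube over \<open>M\<close>.\<close>

lemma compact_poly_mapping_cube:
  assumes "finite M"
  shows "compact {p :: 'a \<Rightarrow>\<^sub>0 real.
    Poly_Mapping.keys p \<subseteq> M \<and> (\<forall>m. \<bar>Poly_Mapping.lookup p m\<bar> \<le> 1)}" (is "compact (?B M)")
  using assms
proof (induction M)
  case empty
  have "?B {} = {0}" by auto
  then show ?case by simp
next
  case (insert a M)
  let ?g = "\<lambda>(c, p). c *\<^sub>R Poly_Mapping.single a (1::real) + p"
  have "?B (insert a M) = ?g ` ({-1..1} \<times> ?B M)"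
  proof (intro equalityI subsetI)
    fix p assume p: "p \<in> ?B (insert a M)"
    define c where "c = Poly_Mapping.lookup p a"
    define q where "q = p - c *\<^sub>R Poly_Mapping.single a 1"
    have lq: "Poly_Mapping.lookup q m = (if m = a then 0 else Poly_Mapping.lookup p m)" for m
      by (auto simp: q_def c_def lookup_minus lookup_scaleR lookup_single when_def)
    have "q \<in> ?B M"
      using p by (auto simp: lq in_keys_iff split: if_splits)
    moreover have "c \<in> {-1..1}"
      using p by (auto simp: c_def abs_le_iff minus_le_iff)
    moreover have "p = ?g (c, q)" by (simp add: q_def)
    ultimately show "p \<in> ?g ` ({-1..1} \<times> ?B M)" by blast
  next
    fix p assume "p \<in> ?g ` ({-1..1} \<times> ?B M)"
    then obtain c q where c: "c \<in> {-1..1}" and q: "q \<in> ?B M"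
      and p: "p = c *\<^sub>R Poly_Mapping.single a 1 + q" by auto
    \<comment> \<open>Since \<open>a\<close> is not in \<open>M\<close>, the summand
      \<open>q\<close> does not contribute at \<open>a\<close>, and \<open>c\<close> alone is the
      coefficient there.\<close>
    have "Poly_Mapping.lookup q a = 0"
      using q insert.hyps by (auto simp: in_keys_iff)
    then have lp: "Poly_Mapping.lookup p m = (if m = a then c else Poly_Mapping.lookup q m)" for m
      by (auto simp: p lookup_add lookup_scaleR lookup_single when_def)
    show "p \<in> ?B (insert a M)"
      using c q by (auto simp: lp in_keys_iff split: if_splits)
  qed
  moreover have "compact (?g ` ({-1..1} \<times> ?B M))"
  proof (rule compact_continuous_image)
    show "continuous_on ({-1..1} \<times> ?B M) ?g"
      unfolding split_def by (intro continuous_intros)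
  qed (intro compact_Times compact_Icc insert.IH)
  ultimately show ?case by simp
qed

section \<open>The finite-dimensional space \<open>polys_le n d\<close>\<close>

text \<open>A monomial is determined by its exponents; each of them is at most the total degree, and
  those outside \<open>{1..n}\<close> vanish.\<close>

lemma finite_monomials_le:
  "finite {m :: monomial. Poly_Mapping.keys m \<subseteq> {1..n} \<and> total_degree m \<le> d}" (is "finite ?M")
proof (rule finite_imageD)
  have le: "Poly_Mapping.lookup m i \<le> d" if "m \<in> ?M" for m :: monomial and i
  proof (cases "i \<in> Poly_Mapping.keys m")
    case True
    then have "Poly_Mapping.lookup m i \<le> total_degree m"
      unfolding total_degree_def by (intro member_le_sum) auto
    with that show ?thesis by simp
  next
    case False
    then show ?thesis by (simp add: in_keys_iff)
  qed
  have zero: "Poly_Mapping.lookup m i = 0" if "m \<in> ?M" "i \<notin> {1..n}" for m :: monomial and i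
    using that in_keys_iff[of i m] by blast
  let ?F = "{g. \<forall>i. (i \<in> {1..n} \<longrightarrow> g i \<in> {..d}) \<and> (i \<notin> {1..n} \<longrightarrow> g i = (0::nat))}"
  have "Poly_Mapping.lookup m \<in> ?F" if "m \<in> ?M" for m :: monomial
    using le[OF that] zero[OF that] by (simp only: mem_Collect_eq atMost_iff) simp
  then have "Poly_Mapping.lookup ` ?M \<subseteq> ?F"
    by (rule image_subsetI)
  moreover have "finite ?F"
    by (rule finite_set_of_finite_funs) simp_all
  ultimately show "finite (Poly_Mapping.lookup ` ?M)"
    by (rule finite_subset)
  show "inj_on Poly_Mapping.lookup ?M"
    by (simp add: inj_on_def poly_mapping.lookup_inject)
qed

lemma polys_le_iff:
  "p \<in> polys_le n d \<longleftrightarrow>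
    Poly_Mapping.keys p \<subseteq> {m. Poly_Mapping.keys m \<subseteq> {1..n} \<and> total_degree m \<le> d}"
  by (auto simp: polys_le_def)

lemma subspace_polys_le: "subspace (polys_le n d)"
proof (rule subspaceI)
  fix p q assume "p \<in> polys_le n d" "q \<in> polys_le n d"
  then show "p + q \<in> polys_le n d"
    using keys_add[of p q] unfolding polys_le_iff by blast
next
  fix c p assume "p \<in> polys_le n d"
  then show "c *\<^sub>R p \<in> polys_le n d"
    unfolding polys_le_iff by (auto simp: in_keys_iff lookup_scaleR)
qed (simp add: polys_le_def)

text \<open>Each coefficient is bounded by the norm, so the unit sphere lies in the unit cube over
  the finitely many admissible monomials, where it is a closed subset of a compact set.\<close>

lemma compact_sphere_polys_le: "compact (polys_le n d \<inter> sphere 0 1)"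
proof -
  let ?M = "{m :: monomial. Poly_Mapping.keys m \<subseteq> {1..n} \<and> total_degree m \<le> d}"
  let ?B = "{p :: real_mpoly. Poly_Mapping.keys p \<subseteq> ?M \<and> (\<forall>m. \<bar>Poly_Mapping.lookup p m\<bar> \<le> 1)}"
  have "polys_le n d \<inter> sphere 0 1 = ?B \<inter> sphere 0 1"
  proof (intro equalityI subsetI)
    fix p assume p: "p \<in> polys_le n d \<inter> sphere 0 1"
    then have "\<bar>Poly_Mapping.lookup p m\<bar> \<le> 1" for m
      using norm_lookup_le[of p m] by simp
    then show "p \<in> ?B \<inter> sphere 0 1"
      using p by (simp add: polys_le_iff)
  qed (simp add: polys_le_iff)
  moreover have "compact (?B \<inter> sphere 0 1)"
    by (intro compact_Int_closed compact_poly_mapping_cube finite_monomials_le)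
      (auto simp: sphere_def intro!: closed_Collect_eq continuous_intros)
  ultimately show ?thesis by simp
qed

section \<open>Functionals that are linear on a subspace\<close>

lemma linear_functional_on_0:
  assumes "linear_functional_on V l" "subspace V"
  shows "l 0 = 0"
  using assms subspace_0[OF assms(2)] unfolding linear_functional_on_def
  by (metis mult_zero_left scaleR_zero_left)

lemma linear_functional_on_sum:
  assumes l: "linear_functional_on V l" and V: "subspace V" and "\<And>i. i \<in> I \<Longrightarrow> v i \<in> V"
  shows "l (\<Sum>i\<in>I. c i *\<^sub>R v i) = (\<Sum>i\<in>I. c i * l (v i))"
  using assms(3)
\<comment> \<open>For infinite \<open>I\<close> both sums are 0 by convention, so this case reduces
  to \<open>l 0 = 0\<close>, as the empty one does.\<close>
proof (induction I rule: infinite_finite_induct)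
  case (insert i I)
  then have "c i *\<^sub>R v i \<in> V" "(\<Sum>i\<in>I. c i *\<^sub>R v i) \<in> V"
    by (auto intro!: subspace_scale[OF V] subspace_sum[OF V])
  then show ?case
    using insert l by (simp add: linear_functional_on_def)
qed (simp_all add: linear_functional_on_0[OF l V])

text \<open>On this space \<open>l\<close> is a finite linear combination of the coefficient
  functionals, which are bounded. Linearity alone would not suffice in infinite dimension.\<close>

lemma continuous_on_linear_functional_polys_le:
  assumes l: "linear_functional_on (polys_le n d) l"
  shows "continuous_on (polys_le n d) l"
proof -
  let ?M = "{m :: monomial. Poly_Mapping.keys m \<subseteq> {1..n} \<and> total_degree m \<le> d}"
  let ?e = "\<lambda>m :: monomial. Poly_Mapping.single m (1::real)"
  have "l p = (\<Sum>m\<in>?M. Poly_Mapping.lookup p m * l (?e m))" if "p \<in> polys_le n d" for p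
  proof -
    have "p = (\<Sum>m\<in>?M. Poly_Mapping.lookup p m *\<^sub>R ?e m)"
      using that finite_monomials_le by (intro poly_mapping_eq_sum_single) (auto simp: polys_le_iff)
    then have "l p = l (\<Sum>m\<in>?M. Poly_Mapping.lookup p m *\<^sub>R ?e m)" by simp
    also have "\<dots> = (\<Sum>m\<in>?M. Poly_Mapping.lookup p m * l (?e m))"
      by (intro linear_functional_on_sum[OF l subspace_polys_le]) (simp add: polys_le_iff)
    finally show ?thesis .
  qed
  moreover have "continuous_on (polys_le n d) (\<lambda>p. \<Sum>m\<in>?M. Poly_Mapping.lookup p m * l (?e m))"
    by (intro continuous_intros linear_continuous_on bounded_linear_lookup)
  ultimately show ?thesis
    by (simp cong: continuous_on_cong)
qed

section \<open>The exponential of a rank-one operator\<close>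

text \<open>Every application of \<open>A\<close> after the first only multiplies by
  \<open>l f\<close>, so from the second term on the series is a scalar exponential series times
  \<open>f\<close>.\<close>

lemma exp_op_rank_one:
  fixes A :: "'a::real_normed_vector \<Rightarrow> 'a"
  assumes V: "subspace V" and l: "linear_functional_on V l"
    and A: "\<And>p. p \<in> V \<Longrightarrow> A p = l p *\<^sub>R f"
    and f: "f \<in> V" "l f \<noteq> 0" and p: "p \<in> V"
  shows "exp_op t A p = p + ((exp (t * l f) - 1) / l f * l p) *\<^sub>R f"
proof -
  have pow: "(A ^^ Suc k) p = (l p * l f ^ k) *\<^sub>R f" for k
  proof (induction k)
    case 0
    then show ?case using A p by simp
  next
    case (Suc k)
    then have "(A ^^ Suc (Suc k)) p = A ((l p * l f ^ k) *\<^sub>R f)" by simp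
    also have "\<dots> = (l p * l f ^ Suc k) *\<^sub>R f"
      using A subspace_scale[OF V f(1)] l f(1) by (simp add: linear_functional_on_def mult_ac)
    finally show ?case .
  qed
  \<comment> \<open>The full scalar series \<open>?r\<close> starts with
    \<open>(l p / l f) *\<^sub>R f\<close> instead of \<open>p\<close>; \<open>?z\<close> corrects
    this one term.\<close>
  let ?r = "\<lambda>k. ((t * l f) ^ k /\<^sub>R fact k * (l p / l f)) *\<^sub>R f"
  let ?z = "\<lambda>k :: nat. if k = 0 then p - (l p / l f) *\<^sub>R f else 0"
  have "?r sums ((exp (t * l f) * (l p / l f)) *\<^sub>R f)"
    by (intro sums_scaleR_left sums_mult2 exp_converges)
  moreover have "?z sums (p - (l p / l f) *\<^sub>R f)"
    using sums_single[of 0 "\<lambda>_. p - (l p / l f) *\<^sub>R f"] by (simp cong: if_cong)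
  ultimately have "(\<lambda>k. ?r k + ?z k) sums
      ((exp (t * l f) * (l p / l f)) *\<^sub>R f + (p - (l p / l f) *\<^sub>R f))"
    by (rule sums_add)
  moreover have "?r k + ?z k = (t ^ k / fact k) *\<^sub>R (A ^^ k) p" for k
  proof (cases k)
    case (Suc j)
    have "?r (Suc j) = (t ^ Suc j / fact (Suc j)) *\<^sub>R (l p * l f ^ j) *\<^sub>R f"
      using f(2) by (simp add: field_simps del: fact_Suc)
    then show ?thesis using pow[of j] Suc by simp
  qed simp
  ultimately have "exp_op t A p = (exp (t * l f) * (l p / l f)) *\<^sub>R f + (p - (l p / l f) *\<^sub>R f)"
    unfolding exp_op_def by (simp add: sums_iff)
  also have "\<dots> = p + ((exp (t * l f) - 1) / l f * l p) *\<^sub>R f"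
    by (simp add: algebra_simps diff_divide_distrib)
  finally show ?thesis .
qed

section \<open>Comparison of the functional with the norm on \<open>S\<close>\<close>

text \<open>By homogeneity it suffices to bound \<open>l\<close> from below on the unit vectors of
  the closed cone. They form a compact set, so \<open>l\<close> attains a positive minimum \<mu>
  there, and \<open>K\<close> is \<open>1 / \<mu>\<close>.\<close>

lemma norm_le_functional_on_cone:
  assumes V: "subspace V" "compact (V \<inter> sphere 0 1)" and S: "S \<subseteq> V"
    and l: "linear_functional_on V l" "continuous_on V l"
    and pos: "\<And>p. p \<in> V \<inter> closure (cone hull S) - {0} \<Longrightarrow> l p > 0"
  shows "\<exists>K>0. \<forall>p\<in>S. norm p \<le> K * l p"
proof -
  let ?D = "V \<inter> sphere 0 1 \<inter> closure (cone hull S)"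
  obtain \<mu> where \<mu>: "\<mu> > 0" "\<And>q. q \<in> ?D \<Longrightarrow> \<mu> \<le> l q"
  proof (cases "?D = {}")
    case True
    \<comment> \<open>Without unit vectors in the closed cone any positive bound holds
      vacuously.\<close>
    show ?thesis by (rule that[of 1]) (use True in auto)
  next
    case False
    have "compact ?D"
      by (intro compact_Int_closed V closed_closure)
    moreover have "continuous_on ?D l"
      using l(2) by (rule continuous_on_subset) blast
    ultimately obtain q where q: "q \<in> ?D" "\<And>r. r \<in> ?D \<Longrightarrow> l q \<le> l r"
      using continuous_attains_inf[OF _ False] by blast
    from q(1) have "l q > 0" by (intro pos) auto
    then show ?thesis using that q(2) by blast
  qed
  have "norm p \<le> (1 / \<mu>) * l p" if p: "p \<in> S" for p
  proof (cases "p = 0")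
    case True
    then show ?thesis by (simp add: linear_functional_on_0[OF l(1) V(1)])
  next
    case False
    let ?q = "(1 / norm p) *\<^sub>R p"
    have "?q \<in> closure (cone hull S)"
      using mem_cone_hull[OF p, of "1 / norm p"] closure_subset by auto
    then have "?q \<in> ?D"
      using p S False subspace_scale[OF V(1)] by auto
    then have "\<mu> \<le> l ?q" by (rule \<mu>(2))
    also have "l ?q = l p / norm p"
      using l(1) p S by (auto simp: linear_functional_on_def)
    finally show ?thesis using False \<mu>(1) by (simp add: field_simps)
  qed
  then show ?thesis using \<mu>(1) by (intro exI[of _ "1 / \<mu>"]) simp
qed

section \<open>The exponential eventually maps \<open>S\<close> into \<open>C\<close>\<close>

theorem theorem7p1:
  fixes n d :: nat
    and S C :: "real_mpoly set"
    and l :: "real_mpoly \<Rightarrow> real"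
    and f :: real_mpoly
    and A :: "real_mpoly \<Rightarrow> real_mpoly"
  assumes "n \<ge> 1"
    and "S \<subseteq> polys_le n d"
    and "C \<subseteq> polys_le n d"
    and "cone_with_zero C"
    and "full_dimensional n d C"
    and "linear_functional_on (polys_le n d) l"
    and "\<And>p. p \<in> ((polys_le_top n d closure_of (cone hull S)) \<union> C) - {0} \<Longrightarrow> l p > 0"
    and "f \<in> polys_le_top n d interior_of C"
    and "\<And>p. p \<in> polys_le n d \<Longrightarrow> A p = l p *\<^sub>R f"
  shows "\<exists>\<tau>>0. \<forall>t\<ge>\<tau>. exp_op t A ` S \<subseteq> C"
proof -
  let ?V = "polys_le n d"
  note V = subspace_polys_le[of n d]
  note l = assms(6)
  have l_scale: "l (c *\<^sub>R p) = c * l p" if "p \<in> ?V" for c p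
    using l that by (simp add: linear_functional_on_def)
  have C_scale: "c *\<^sub>R p \<in> C" if "p \<in> C" "c \<ge> 0" for c p
    using assms(4) that by (simp add: cone_with_zero_def mem_cone)
  have fC: "f \<in> C"
    using interior_of_subset assms(8) by (rule subsetD)
  then have fV: "f \<in> ?V"
    using assms(3) by (rule rev_subsetD)
  obtain T where "openin (top_of_set ?V) T" "f \<in> T" "T \<subseteq> C"
    using assms(8) unfolding polys_le_top_def interior_of_def by blast
  then obtain U where U: "open U" "f \<in> U" "?V \<inter> U \<subseteq> C"
    unfolding openin_open by blast
  obtain \<epsilon> where \<epsilon>: "\<epsilon> > 0" "ball f \<epsilon> \<subseteq> U"
    using openE[OF U(1,2)] by blast
  \<comment> \<open>The interior is relative to \<open>?V\<close>, so only perturbations inside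
    \<open>?V\<close> are allowed.\<close>
  have near: "f + v \<in> C" if "v \<in> ?V" "norm v < \<epsilon>" for v
  proof -
    have "f + v \<in> ball f \<epsilon>" using that by (simp add: dist_norm)
    then show ?thesis using U \<epsilon> subspace_add[OF V fV] that by blast
  qed
  \<comment> \<open>Otherwise \<open>C\<close> would contain a relative neighbourhood of 0, hence
    some \<open>w\<close> and \<open>- w\<close> with \<open>w\<close> nonzero, and \<open>l\<close>
    cannot be positive at both. The constant polynomial 1 provides a nonzero direction for all
    \<open>n\<close> and \<open>d\<close>.\<close>
  have "f \<noteq> 0"
  proof
    assume f0: "f = 0"
    define v :: real_mpoly where "v = Poly_Mapping.single 0 1"
    have v: "v \<in> ?V" "v \<noteq> 0"
      by (simp_all add: v_def polys_le_def total_degree_def)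
    define w where "w = (\<epsilon> / (2 * norm v)) *\<^sub>R v"
    have w: "w \<in> ?V" "w \<noteq> 0" "norm w < \<epsilon>"
      using subspace_scale[OF V v(1)] v(2) \<epsilon>(1) by (simp_all add: w_def)
    have "w \<in> C" "- w \<in> C"
      using near[of w] near[of "- w"] w(1,3) f0 subspace_neg[OF V w(1)] by simp_all
    then have "l w > 0" "l (- w) > 0"
      using w(2) by (auto intro!: assms(7))
    then show False using l_scale[OF w(1), of "-1"] by simp
  qed
  then have lf: "l f > 0" using fC by (intro assms(7)) auto
  \<comment> \<open>As \<open>cone hull S\<close> lies in \<open>?V\<close>, its closure relative to
    \<open>?V\<close> is the ambient closure intersected with \<open>?V\<close>.\<close>
  have pos: "l p > 0" if "p \<in> ?V \<inter> closure (cone hull S) - {0}" for p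
  proof (rule assms(7))
    have "cone hull S \<subseteq> ?V"
      by (rule hull_minimal) (use assms(2) V in \<open>auto simp: cone_def subspace_scale\<close>)
    then have "?V \<inter> cone hull S = cone hull S" by blast
    then show "p \<in> polys_le_top n d closure_of (cone hull S) \<union> C - {0}"
      using that by (simp add: polys_le_top_def closure_of_subtopology)
  qed
  have "\<exists>K>0. \<forall>p\<in>S. norm p \<le> K * l p"
    by (rule norm_le_functional_on_cone[OF V compact_sphere_polys_le assms(2) l
          continuous_on_linear_functional_polys_le[OF l]]) (rule pos)
  then obtain K where K: "K > 0" "\<And>p. p \<in> S \<Longrightarrow> norm p \<le> K * l p"
    by blast
  \<comment> \<open>The factor 2 makes \<open>K < t * \<epsilon>\<close> strict, as the open ball
    requires.\<close>
  have "exp_op t A p \<in> C" if t: "t \<ge> 2 * K / \<epsilon>" and p: "p \<in> S" for t p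
  proof -
    have pV: "p \<in> ?V" using p assms(2) by blast
    define s where "s = (exp (t * l f) - 1) / l f"
    have exp_eq: "exp_op t A p = p + (s * l p) *\<^sub>R f"
      unfolding s_def using lf by (intro exp_op_rank_one[OF V l assms(9) fV _ pV]) simp_all
    have "t > 0" using t K(1) \<epsilon>(1) by (smt (verit) divide_pos_pos)
    \<comment> \<open>This is \<open>exp x \<ge> 1 + x\<close> at \<open>x = t * l f\<close>,
      divided by \<open>l f\<close>.\<close>
    have "t \<le> s"
      using exp_ge_add_one_self[of "t * l f"] lf by (simp add: s_def field_simps)
    show ?thesis
    \<comment> \<open>At \<open>p = 0\<close> the factor \<open>s * l p\<close> vanishes and cannot
      be divided out, but the image is then 0, which lies in \<open>C\<close>.\<close>
    proof (cases "p = 0")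
      case True
      with assms(4) show ?thesis
        unfolding exp_eq by (simp add: linear_functional_on_0[OF l V] cone_with_zero_def)
    next
      case False
      have "0 < K * l p" using K(2)[OF p] False by (smt (verit) zero_less_norm_iff)
      then have lp: "l p > 0" using K(1) by (simp add: zero_less_mult_iff)
      have sp: "s * l p > 0" using \<open>t > 0\<close> \<open>t \<le> s\<close> lp by simp
      have "K < t * \<epsilon>"
        using t K(1) \<epsilon>(1) by (simp add: field_simps)
      also have "\<dots> \<le> s * \<epsilon>"
        using \<open>t \<le> s\<close> \<epsilon>(1) by simp
      finally have "K < s * \<epsilon>" .
      then have "K * l p < s * \<epsilon> * l p" using lp by simp
      then have "norm p < \<epsilon> * (s * l p)" using K(2)[OF p] by (simp add: mult_ac)
      then have "norm ((1 / (s * l p)) *\<^sub>R p) < \<epsilon>"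
        using sp by (simp only: norm_scaleR) (simp add: field_simps)
      then have "f + (1 / (s * l p)) *\<^sub>R p \<in> C"
        using near subspace_scale[OF V pV] by blast
      then have "(s * l p) *\<^sub>R (f + (1 / (s * l p)) *\<^sub>R p) \<in> C"
        using sp by (intro C_scale) auto
      \<comment> \<open>With \<open>r = s * l p\<close> this identifies the rescaled point of
        \<open>C\<close> with \<open>exp_op t A p\<close>.\<close>
      moreover have "r *\<^sub>R (f + (1 / r) *\<^sub>R p) = p + r *\<^sub>R f" if "r > 0" for r
        using that by (simp add: scaleR_add_right)
      ultimately show ?thesis
        using sp unfolding exp_eq by metis
    qed
  qed
  then show ?thesis
    using K(1) \<epsilon>(1) by (intro exI[of _ "2 * K / \<epsilon>"]) auto
qed

end
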